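(* Let $I=[a,b]\subset\mathbb{R}$ be a compact interval and let $f:I\to\mathbb{R}$. Then $f$ is Darboux Henstock integrable on $I$ if and only if $f$ is Sequential Henstock integrable on $I$, and in that case the two integrals of $f$ on $I$ have the same value.
   Context: A tagged partition $P=\{([x_{i-1},x_i],t_i)\}_{i=1}^k$ of $I=[a,b]$ consists of points $a=x_0<x_1<\dots<x_k=b$ together with tags $t_i\in[x_{i-1},x_i]$. Its Riemann sum for $f$ is $S(f,P)=\sum_{i=1}^k f(t_i)(x_i-x_{i-1})$. A gauge on $I$ is a function $\delta:I\to\mathbb{R}$ with $\delta(x)>0$ for all $x\in I$. $P$ is $\delta(x)$-fine if $x_i-x_{i-1}<\delta(t_i)$ for every $i$. For every gauge on $I$, a $\delta(x)$-fine tagged partition of $I$ exists (Cousin's Lemma). For a gauge $\delta$, let $\beta_\delta$ be the set of all $\delta(x)$-fine tagged partitions of $I$, and define the lower and upper sums (in the extended reals) by $$L(f,\delta)=\inf_{P\in\beta_\delta}S(f,P),\qquad U(f,\delta)=\sup_{P\in\beta_\delta}S(f,P).$$ The lower integral of $f$ is $\underline{\int}_I f=\sup_{\delta}L(f,\delta)$ and the upper integral of $f$ is $\overline{\int}_I f=\inf_{\delta}U(f,\delta)$, with $\delta$ ranging over all gauges on $I$. $f$ is Darboux Henstock integrable on $I$ if $\underline{\int}_I f$ and $\overline{\int}_I f$ are finite and $\left|\overline{\int}_I f-\underline{\int}_I f\right|<\epsilon$ for each $\epsilon>0$; in this case its integral is the common value $\int_I f=\underline{\int}_I f=\overline{\int}_I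 f$. $f$ is Sequential Henstock integrable on $I$ with integral $A\in\mathbb{R}$ if there is a sequence of gauges $\{\delta_n\}_{n=1}^\infty$ on $I$ such that, whenever $P_n$ is a $\delta_n(x)$-fine tagged partition of $I$ for each $n$, one has $S(f,P_n)\to A$ as $n\to\infty$. *)

theory Defs
  imports Complex_Main "HOL-Library.Extended_Real"
begin

text \<open>
  A triple \<open>(k, x, t)\<close> stands for the tagged partition \<open>{([x (i-1), x i], t i)}\<close>, \<open>i = 1..k\<close>.
  Only \<open>x 0, ..., x k\<close> and \<open>t 1, ..., t k\<close> are relevant.
  No lower bound on \<open>k\<close> is imposed: \<open>a < b\<close> forces \<open>k \<ge> 1\<close>, and for \<open>a = b\<close> the only
  possibility is \<open>k = 0\<close>, with Riemann sum 0.
\<close>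

type_synonym tagged_points = "nat \<times> (nat \<Rightarrow> real) \<times> (nat \<Rightarrow> real)"

definition tagged_partition :: "real \<Rightarrow> real \<Rightarrow> tagged_points \<Rightarrow> bool" where
  "tagged_partition a b P \<longleftrightarrow>
     (case P of (k, x, t) \<Rightarrow>
        x 0 = a \<and> x k = b \<and>
        (\<forall>i\<in>{1..k}. x (i - 1) < x i \<and> t i \<in> {x (i - 1)..x i}))"

definition riemann_sum :: "(real \<Rightarrow> real) \<Rightarrow> tagged_points \<Rightarrow> real" where
  "riemann_sum f P = (case P of (k, x, t) \<Rightarrow> \<Sum>i=1..k. f (t i) * (x i - x (i - 1)))"

text \<open>
  Gauges are positive functions and fineness bounds the length of each subinterval; this differs
  from the open-set-valued \<open>gauge\<close> and the inclusion-based \<open>fine\<close> of HOL-Analysis.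
\<close>

definition gauge_on :: "real \<Rightarrow> real \<Rightarrow> (real \<Rightarrow> real) \<Rightarrow> bool" where
  "gauge_on a b \<delta> \<longleftrightarrow> (\<forall>x\<in>{a..b}. \<delta> x > 0)"

definition delta_fine :: "(real \<Rightarrow> real) \<Rightarrow> tagged_points \<Rightarrow> bool" where
  "delta_fine \<delta> P \<longleftrightarrow> (case P of (k, x, t) \<Rightarrow> \<forall>i\<in>{1..k}. x i - x (i - 1) < \<delta> (t i))"

definition fine_partitions :: "real \<Rightarrow> real \<Rightarrow> (real \<Rightarrow> real) \<Rightarrow> tagged_points set" where
  "fine_partitions a b \<delta> = {P. tagged_partition a b P \<and> delta_fine \<delta> P}"

definition lower_sum :: "real \<Rightarrow> real \<Rightarrow> (real \<Rightarrow> real) \<Rightarrow> (real \<Rightarrow> real) \<Rightarrow> ereal" where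
  "lower_sum a b f \<delta> = (INF P\<in>fine_partitions a b \<delta>. ereal (riemann_sum f P))"

definition upper_sum :: "real \<Rightarrow> real \<Rightarrow> (real \<Rightarrow> real) \<Rightarrow> (real \<Rightarrow> real) \<Rightarrow> ereal" where
  "upper_sum a b f \<delta> = (SUP P\<in>fine_partitions a b \<delta>. ereal (riemann_sum f P))"

definition lower_integral :: "real \<Rightarrow> real \<Rightarrow> (real \<Rightarrow> real) \<Rightarrow> ereal" where
  "lower_integral a b f = (SUP \<delta>\<in>{\<delta>. gauge_on a b \<delta>}. lower_sum a b f \<delta>)"

definition upper_integral :: "real \<Rightarrow> real \<Rightarrow> (real \<Rightarrow> real) \<Rightarrow> ereal" where
  "upper_integral a b f = (INF \<delta>\<in>{\<delta>. gauge_on a b \<delta>}. upper_sum a b f \<delta>)"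

definition darboux_henstock_integrable :: "real \<Rightarrow> real \<Rightarrow> (real \<Rightarrow> real) \<Rightarrow> bool" where
  "darboux_henstock_integrable a b f \<longleftrightarrow>
     \<bar>lower_integral a b f\<bar> \<noteq> \<infinity> \<and> \<bar>upper_integral a b f\<bar> \<noteq> \<infinity> \<and>
     (\<forall>\<epsilon>::real. \<epsilon> > 0 \<longrightarrow> \<bar>upper_integral a b f - lower_integral a b f\<bar> < ereal \<epsilon>)"

definition has_darboux_henstock_integral :: "real \<Rightarrow> real \<Rightarrow> (real \<Rightarrow> real) \<Rightarrow> real \<Rightarrow> bool" where
  "has_darboux_henstock_integral a b f A \<longleftrightarrow>
     darboux_henstock_integrable a b f \<and>
     lower_integral a b f = ereal A \<and> upper_integral a b f = ereal A"

definition has_sequential_henstock_integral :: "real \<Rightarrow> real \<Rightarrow> (real \<Rightarrow> real) \<Rightarrow> real \<Rightarrow> bool" where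
  "has_sequential_henstock_integral a b f A \<longleftrightarrow>
     (\<exists>\<delta> :: nat \<Rightarrow> real \<Rightarrow> real.
        (\<forall>n. gauge_on a b (\<delta> n)) \<and>
        (\<forall>P. (\<forall>n. P n \<in> fine_partitions a b (\<delta> n)) \<longrightarrow>
             (\<lambda>n. riemann_sum f (P n)) \<longlonglongrightarrow> A))"

definition sequential_henstock_integrable :: "real \<Rightarrow> real \<Rightarrow> (real \<Rightarrow> real) \<Rightarrow> bool" where
  "sequential_henstock_integrable a b f \<longleftrightarrow> (\<exists>A. has_sequential_henstock_integral a b f A)"

end

theory Submission
  imports Defs
begin

text \<open>
  Both notions of integral are equivalent to the usual \<open>\<epsilon>\<close>-\<open>\<delta>\<close> definition of the Henstock integral:
  for every \<open>\<epsilon> > 0\<close> some gauge forces the Riemann sums of all its fine partitions to lie within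
  \<open>\<epsilon>\<close> of \<open>A\<close>. Hence they have the same integrals, and with them the same integrable functions.

  For the Darboux side, a lower sum close to \<open>A\<close> and an upper sum close to \<open>A\<close> come from two
  gauges, whose minimum then controls the Riemann sums from both sides. Conversely, a gauge for
  \<open>\<epsilon>\<close> has lower sum at least \<open>A - \<epsilon>\<close> and upper sum at most \<open>A + \<epsilon>\<close>, so both integrals are
  squeezed to \<open>A\<close> once the lower integral is known not to exceed the upper one. This last
  inequality is where Cousin's lemma enters: without a fine partition, a lower sum would be
  \<open>\<infinity>\<close> and an upper sum \<open>-\<infinity>\<close>.

  For the sequential side, gauges for \<open>\<epsilon> = 1 / (n + 1)\<close> form a suitable sequence. Conversely, if no
  gauge works for some \<open>\<epsilon>\<close>, then each gauge of a given sequence has a fine partition whose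
  Riemann sum is at least \<open>\<epsilon>\<close> away from \<open>A\<close>, and these sums cannot converge to \<open>A\<close>.
\<close>

section \<open>Existence of fine partitions\<close>

lemma fine_partitions_iff:
  "(k, x, t) \<in> fine_partitions a b \<delta> \<longleftrightarrow>
    x 0 = a \<and> x k = b \<and>
    (\<forall>i\<in>{1..k}. x (i - 1) < x i \<and> t i \<in> {x (i - 1)..x i} \<and> x i - x (i - 1) < \<delta> (t i))"
  by (auto simp: fine_partitions_def tagged_partition_def delta_fine_def)

lemma fine_partitions_concat:
  assumes "fine_partitions a b \<delta> \<noteq> {}" and "fine_partitions b c \<delta> \<noteq> {}"
  shows "fine_partitions a c \<delta> \<noteq> {}"
proof -
  obtain k x t where 1: "(k, x, t) \<in> fine_partitions a b \<delta>"
    using assms(1) by auto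
  obtain l y s where 2: "(l, y, s) \<in> fine_partitions b c \<delta>"
    using assms(2) by auto
  define z where "z i = (if i \<le> k then x i else y (i - k))" for i
  define r where "r i = (if i \<le> k then t i else s (i - k))" for i
  have "z (i - 1) < z i \<and> r i \<in> {z (i - 1)..z i} \<and> z i - z (i - 1) < \<delta> (r i)"
    if i: "i \<in> {1..k + l}" for i
  proof (cases "i \<le> k")
    case True
    then show ?thesis
      using 1 i by (auto simp: fine_partitions_iff z_def r_def)
  next
    case False
    \<comment> \<open>The junction \<open>x k = b = y 0\<close> makes this hold for \<open>i = k + 1\<close> too.\<close>
    have "z (i - 1) = y (i - k - 1)"
      using 1 2 False by (cases "i = Suc k") (auto simp: fine_partitions_iff z_def)
    moreover have "z i = y (i - k)" "r i = s (i - k)" "i - k \<in> {1..l}"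
      using False i by (auto simp: z_def r_def)
    ultimately show ?thesis
      using 2 by (simp only: fine_partitions_iff)
  qed
  moreover have "z 0 = a" "z (k + l) = c"
    using 1 2 by (auto simp: z_def fine_partitions_iff)
  ultimately have "(k + l, z, r) \<in> fine_partitions a c \<delta>"
    by (simp only: fine_partitions_iff) blast
  then show ?thesis
    by blast
qed

lemma fine_partitions_single_tag:
  assumes "u \<le> x" "x \<le> v" "v - u < \<delta> x"
  shows "fine_partitions u v \<delta> \<noteq> {}"
proof (cases "u = v")
  case True
  then have "(0, \<lambda>_. u, \<lambda>_. x) \<in> fine_partitions u v \<delta>"
    by (simp add: fine_partitions_iff)
  then show ?thesis
    by blast
next
  case False
  then have "(1, \<lambda>i. if i = 0 then u else v, \<lambda>_. x) \<in> fine_partitions u v \<delta>"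
    using assms by (simp add: fine_partitions_iff)
  then show ?thesis
    by blast
qed

text \<open>
  Cousin's lemma, by bisection: having a fine partition passes to unions of adjacent intervals, and
  near each point \<open>x\<close> it holds because a short interval around \<open>x\<close> can be tagged by \<open>x\<close> alone.
\<close>

lemma fine_partitions_nonempty:
  assumes "a \<le> b" and "gauge_on a b \<delta>"
  shows "fine_partitions a b \<delta> \<noteq> {}"
  using \<open>a \<le> b\<close>
proof (induction rule: Bolzano)
  case (trans u v w)
  then show ?case
    using fine_partitions_concat by blast
next
  case (local x)
  then have "\<delta> x > 0"
    using assms(2) by (simp add: gauge_on_def)
  then show ?case
    using fine_partitions_single_tag by blast
qed

section \<open>Comparing lower and upper sums\<close>

lemma gauge_on_min:
  "gauge_on a b \<delta> \<Longrightarrow> gauge_on a b \<delta>' \<Longrightarrow> gauge_on a b (\<lambda>x. min (\<delta> x) (\<delta>' x))"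
  by (simp add: gauge_on_def)

lemma fine_partitions_min:
  "fine_partitions a b (\<lambda>x. min (\<delta> x) (\<delta>' x)) = fine_partitions a b \<delta> \<inter> fine_partitions a b \<delta>'"
  by (auto simp: fine_partitions_def delta_fine_def)

lemma lower_sum_le:
  "P \<in> fine_partitions a b \<delta> \<Longrightarrow> lower_sum a b f \<delta> \<le> ereal (riemann_sum f P)"
  unfolding lower_sum_def by (rule INF_lower)

lemma le_upper_sum:
  "P \<in> fine_partitions a b \<delta> \<Longrightarrow> ereal (riemann_sum f P) \<le> upper_sum a b f \<delta>"
  unfolding upper_sum_def by (rule SUP_upper)

text \<open>Any two gauges share a fine partition, and its Riemann sum separates the two sums.\<close>

lemma lower_sum_le_upper_sum:
  assumes "a \<le> b" "gauge_on a b \<delta>" "gauge_on a b \<delta>'"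
  shows "lower_sum a b f \<delta> \<le> upper_sum a b f \<delta>'"
proof -
  obtain P where "P \<in> fine_partitions a b \<delta>" "P \<in> fine_partitions a b \<delta>'"
    using fine_partitions_nonempty[OF assms(1) gauge_on_min[OF assms(2,3)]]
    unfolding fine_partitions_min by blast
  then show ?thesis
    using lower_sum_le le_upper_sum order_trans by blast
qed

lemma lower_integral_le_upper_integral:
  assumes "a \<le> b"
  shows "lower_integral a b f \<le> upper_integral a b f"
  unfolding lower_integral_def upper_integral_def
  using lower_sum_le_upper_sum[OF assms] by (intro SUP_least INF_greatest) simp

section \<open>The \<open>\<epsilon>\<close>-\<open>\<delta>\<close> integral as common characterization\<close>

definition has_henstock_integral :: "real \<Rightarrow> real \<Rightarrow> (real \<Rightarrow> real) \<Rightarrow> real \<Rightarrow> bool" where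
  "has_henstock_integral a b f A \<longleftrightarrow>
     (\<forall>\<epsilon>>0. \<exists>\<delta>. gauge_on a b \<delta> \<and> (\<forall>P\<in>fine_partitions a b \<delta>. \<bar>riemann_sum f P - A\<bar> < \<epsilon>))"

text \<open>
  Finite numbers whose distance is below every \<open>\<epsilon> > 0\<close> are equal, so Darboux Henstock
  integrability only asks the two integrals to be the same real number.
\<close>

lemma has_darboux_henstock_integral_iff:
  "has_darboux_henstock_integral a b f A \<longleftrightarrow>
    lower_integral a b f = ereal A \<and> upper_integral a b f = ereal A"
  by (auto simp: has_darboux_henstock_integral_def darboux_henstock_integrable_def)

lemma darboux_henstock_integrable_iff:
  "darboux_henstock_integrable a b f \<longleftrightarrow> (\<exists>A. has_darboux_henstock_integral a b f A)"
proof
  assume int: "darboux_henstock_integrable a b f"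
  then obtain L U where LU: "lower_integral a b f = ereal L" "upper_integral a b f = ereal U"
    by (auto simp: darboux_henstock_integrable_def)
  have "\<bar>U - L\<bar> < \<epsilon>" if "\<epsilon> > 0" for \<epsilon>
    using int that by (simp add: darboux_henstock_integrable_def LU)
  from this[of "\<bar>U - L\<bar>"] have "U = L"
    by auto
  then show "\<exists>A. has_darboux_henstock_integral a b f A"
    using LU by (auto simp: has_darboux_henstock_integral_iff)
qed (auto simp: has_darboux_henstock_integral_def)

lemma has_darboux_henstock_integral_iff_henstock:
  assumes "a \<le> b"
  shows "has_darboux_henstock_integral a b f A \<longleftrightarrow> has_henstock_integral a b f A"
proof
  assume "has_darboux_henstock_integral a b f A"
  then have L: "lower_integral a b f = ereal A" and U: "upper_integral a b f = ereal A"
    by (auto simp: has_darboux_henstock_integral_iff)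
  show "has_henstock_integral a b f A"
    unfolding has_henstock_integral_def
  proof (intro allI impI)
    fix \<epsilon> :: real
    assume "\<epsilon> > 0"
    then have "ereal (A - \<epsilon>) < lower_integral a b f" "upper_integral a b f < ereal (A + \<epsilon>)"
      by (simp_all add: L U)
    then obtain \<delta> \<delta>' where
      \<delta>: "gauge_on a b \<delta>" "ereal (A - \<epsilon>) < lower_sum a b f \<delta>" and
      \<delta>': "gauge_on a b \<delta>'" "upper_sum a b f \<delta>' < ereal (A + \<epsilon>)"
      by (auto simp: lower_integral_def upper_integral_def less_SUP_iff INF_less_iff)
    have "\<bar>riemann_sum f P - A\<bar> < \<epsilon>"
      if "P \<in> fine_partitions a b (\<lambda>x. min (\<delta> x) (\<delta>' x))" for P
    proof -
      have "ereal (A - \<epsilon>) < ereal (riemann_sum f P)"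
        using \<delta>(2) lower_sum_le that unfolding fine_partitions_min
        by (blast intro: less_le_trans)
      moreover have "ereal (riemann_sum f P) < ereal (A + \<epsilon>)"
        using \<delta>'(2) le_upper_sum that unfolding fine_partitions_min
        by (blast intro: le_less_trans)
      ultimately show ?thesis
        by (simp add: abs_less_iff)
    qed
    then show "\<exists>\<delta>. gauge_on a b \<delta> \<and> (\<forall>P\<in>fine_partitions a b \<delta>. \<bar>riemann_sum f P - A\<bar> < \<epsilon>)"
      using gauge_on_min[OF \<delta>(1) \<delta>'(1)] by blast
  qed
next
  assume H: "has_henstock_integral a b f A"
  have bounds: "ereal A \<le> lower_integral a b f + ereal \<epsilon> \<and> upper_integral a b f \<le> ereal A + ereal \<epsilon>"
    if pos: "\<epsilon> > 0" for \<epsilon>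
  proof -
    obtain \<delta> where \<delta>: "gauge_on a b \<delta>"
      "\<And>P. P \<in> fine_partitions a b \<delta> \<Longrightarrow> \<bar>riemann_sum f P - A\<bar> < \<epsilon>"
      using H pos unfolding has_henstock_integral_def by metis
    have "ereal (A - \<epsilon>) \<le> lower_sum a b f \<delta>"
      unfolding lower_sum_def using \<delta>(2) by (force intro!: INF_greatest)
    also have "\<dots> \<le> lower_integral a b f"
      unfolding lower_integral_def using \<delta>(1) by (intro SUP_upper) simp
    finally have "ereal A \<le> lower_integral a b f + ereal \<epsilon>"
      by (cases "lower_integral a b f") auto
    moreover have "upper_sum a b f \<delta> \<le> ereal (A + \<epsilon>)"
      unfolding upper_sum_def using \<delta>(2) by (force intro!: SUP_least)
    moreover have "upper_integral a b f \<le> upper_sum a b f \<delta>"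
      unfolding upper_integral_def using \<delta>(1) by (intro INF_lower) simp
    ultimately show ?thesis
      by auto
  qed
  have "ereal A \<le> lower_integral a b f" "upper_integral a b f \<le> ereal A"
    using bounds by (blast intro: ereal_le_epsilon2)+
  then show "has_darboux_henstock_integral a b f A"
    using lower_integral_le_upper_integral[OF assms, of f]
    unfolding has_darboux_henstock_integral_iff by (intro conjI; order)
qed

lemma has_sequential_henstock_integral_iff_henstock:
  "has_sequential_henstock_integral a b f A \<longleftrightarrow> has_henstock_integral a b f A"
proof
  assume "has_sequential_henstock_integral a b f A"
  then obtain \<delta> where gauge: "\<And>n. gauge_on a b (\<delta> n)"
    and conv: "\<And>P. (\<And>n. P n \<in> fine_partitions a b (\<delta> n)) \<Longrightarrow>
      (\<lambda>n. riemann_sum f (P n)) \<longlonglongrightarrow> A"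
    unfolding has_sequential_henstock_integral_def by blast
  show "has_henstock_integral a b f A"
  proof (rule ccontr)
    assume "\<not> has_henstock_integral a b f A"
    then obtain \<epsilon> where "\<epsilon> > 0" and
      "\<And>n. \<exists>P\<in>fine_partitions a b (\<delta> n). \<not> \<bar>riemann_sum f P - A\<bar> < \<epsilon>"
      unfolding has_henstock_integral_def using gauge by blast
    then obtain P where P: "\<And>n. P n \<in> fine_partitions a b (\<delta> n)"
      and far: "\<And>n. \<not> \<bar>riemann_sum f (P n) - A\<bar> < \<epsilon>"
      by metis
    then show False
      using LIMSEQ_D[OF conv[OF P] \<open>\<epsilon> > 0\<close>] by auto
  qed
next
  assume "has_henstock_integral a b f A"
  then have "\<exists>\<delta>. gauge_on a b \<delta> \<and>
      (\<forall>P\<in>fine_partitions a b \<delta>. \<bar>riemann_sum f P - A\<bar> < 1 / real (Suc n))" for n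
    unfolding has_henstock_integral_def
    using of_nat_0_less_iff zero_less_Suc zero_less_divide_1_iff by blast
  then obtain \<delta> where gauge: "\<And>n. gauge_on a b (\<delta> n)" and close:
    "\<And>n P. P \<in> fine_partitions a b (\<delta> n) \<Longrightarrow> \<bar>riemann_sum f P - A\<bar> < 1 / real (Suc n)"
    by metis
  have "(\<lambda>n. riemann_sum f (P n)) \<longlonglongrightarrow> A"
    if "\<forall>n. P n \<in> fine_partitions a b (\<delta> n)" for P
    by (intro LIM_zero_cancel[OF LIMSEQ_norm_0])
      (simp only: real_norm_def close that)
  then show "has_sequential_henstock_integral a b f A"
    unfolding has_sequential_henstock_integral_def using gauge by blast
qed

theorem theorem2:
  fixes a b :: real and f :: "real \<Rightarrow> real"
  assumes "a \<le> b"
  shows "(darboux_henstock_integrable a b f \<longleftrightarrow> sequential_henstock_integrable a b f) \<and>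
    (darboux_henstock_integrable a b f \<longrightarrow>
      (\<forall>A. has_darboux_henstock_integral a b f A \<longleftrightarrow> has_sequential_henstock_integral a b f A))"
  using assms
  by (simp add: darboux_henstock_integrable_iff sequential_henstock_integrable_def
      has_darboux_henstock_integral_iff_henstock has_sequential_henstock_integral_iff_henstock)

end
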